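(* Let $\mathbb{E}_1,\mathbb{E}_2$ be Euclidean spaces, let $K\subset\mathbb{E}_2$ be a closed convex cone and let $F:\mathbb{E}_1\to\mathbb{E}_2^\bullet$ be proper, $K$-convex and $K$-closed. Then $$K\text{-}\mathrm{epi}\,F=\overline{\mathrm{conv}}(\mathrm{gph}\,F)\quad\Longleftrightarrow\quad \{0\}\times K\subset[\overline{\mathrm{conv}}(\mathrm{gph}\,F)]^\infty .$$
   Context: A Euclidean space is a finite-dimensional real inner product space. A cone is a nonempty set $K$ with $\lambda x\in K$ for all $\lambda\ge 0$, $x\in K$. $\mathbb{E}_2^\bullet:=\mathbb{E}_2\cup\{+\infty_\bullet\}$, where $+\infty_\bullet$ is a formal largest element; $\mathrm{dom}\,F:=\{x\in\mathbb{E}_1 : F(x)\in\mathbb{E}_2\}$ and $\mathrm{gph}\,F:=\{(x,F(x)) : x\in\mathrm{dom}\,F\}$. The $K$-epigraph is $K\text{-}\mathrm{epi}\,F:=\{(x,y)\in\mathrm{dom}\,F\times\mathbb{E}_2 : y-F(x)\in K\}$. $F$ is proper if $\mathrm{dom}\,F\neq\emptyset$, $K$-convex if $K\text{-}\mathrm{epi}\,F$ is convex, and $K$-closed if $K\text{-}\mathrm{epi}\,F$ is closed in $\mathbb{E}_1\times\mathbb{E}_2$. $\overline{\mathrm{conv}}$ denotes the closed convex hull. The horizon cone of a set $C$ is $C^\infty:=\{u : \exists\, t_k\downarrow 0,\ x_k\in C \text{ with } t_kx_k\to u\}$. *)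

theory Defs
  imports "HOL-Analysis.Analysis"
begin

text \<open>
  Finite-dimensional real inner product spaces. The library class \<open>euclidean_space\<close> demands a
  nonempty basis and so excludes the zero space, which is admitted here.
\<close>

class fin_dim_real_inner = real_inner +
  assumes finite_spanning_set: "\<exists>B. finite B \<and> (\<forall>x. \<exists>c. x = (\<Sum>b\<in>B. c b *\<^sub>R b))"

lemma fin_dim_real_inner_span: "\<exists>B :: 'a::fin_dim_real_inner set. finite B \<and> span B = UNIV"
proof -
  obtain B :: "'a set" where B: "finite B" "\<And>x. \<exists>c. x = (\<Sum>b\<in>B. c b *\<^sub>R b)"
    using finite_spanning_set by blast
  have "x \<in> span B" for x
  proof -
    obtain c where "x = (\<Sum>b\<in>B. c b *\<^sub>R b)"
      using B(2) by blast
    then show ?thesis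
      by (simp add: span_base span_scale span_sum)
  qed
  then show ?thesis
    using B(1) by blast
qed

instance euclidean_space \<subseteq> fin_dim_real_inner
proof
  have "\<forall>x::'a. \<exists>c. x = (\<Sum>b\<in>Basis. c b *\<^sub>R b)"
    by (intro allI exI) (rule euclidean_representation[symmetric])
  then show "\<exists>B :: 'a set. finite B \<and> (\<forall>x. \<exists>c. x = (\<Sum>b\<in>B. c b *\<^sub>R b))"
    using finite_Basis by blast
qed

text \<open>
  A function \<open>F : E\<^sub>1 \<rightarrow> E\<^sub>2 \<union> {+\<infinity>}\<close> is a map \<open>'a \<Rightarrow> 'b option\<close>, with \<open>None\<close> for the formal element
  \<open>+\<infinity>\<close>. Its domain is then \<^const>\<open>dom\<close> and its graph is \<^const>\<open>Map.graph\<close>.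
\<close>

definition K_epi :: "'b set \<Rightarrow> ('a \<Rightarrow> 'b::real_vector option) \<Rightarrow> ('a \<times> 'b) set" where
  "K_epi K F = {(x, y). x \<in> dom F \<and> y - the (F x) \<in> K}"

definition proper :: "('a \<Rightarrow> 'b option) \<Rightarrow> bool" where
  "proper F \<longleftrightarrow> dom F \<noteq> {}"

definition K_convex :: "'b set \<Rightarrow> ('a::real_vector \<Rightarrow> 'b::real_vector option) \<Rightarrow> bool" where
  "K_convex K F \<longleftrightarrow> convex (K_epi K F)"

definition K_closed :: "'b set \<Rightarrow> ('a::topological_space \<Rightarrow> 'b::real_normed_vector option) \<Rightarrow> bool" where
  "K_closed K F \<longleftrightarrow> closed (K_epi K F)"

definition closed_convex_hull :: "'a::real_normed_vector set \<Rightarrow> 'a set" where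
  "closed_convex_hull S = closure (convex hull S)"

text \<open>
  \<open>t\<^sub>k \<down> 0\<close> is read as: \<open>t\<^sub>k > 0\<close> and \<open>t\<^sub>k \<rightarrow> 0\<close>. Requiring the sequence to be decreasing in addition
  gives the same set (lemma \<open>horizon_cone_decseq\<close>).
\<close>

definition horizon_cone :: "'a::real_normed_vector set \<Rightarrow> 'a set" where
  "horizon_cone C = {u. \<exists>(t :: nat \<Rightarrow> real) x.
      (\<forall>k. t k > 0) \<and> t \<longlonglongrightarrow> 0 \<and> (\<forall>k. x k \<in> C) \<and> (\<lambda>k. t k *\<^sub>R x k) \<longlonglongrightarrow> u}"

lemma horizon_cone_decseq:
  "horizon_cone C = {u. \<exists>(t :: nat \<Rightarrow> real) x.
      (\<forall>k. t k > 0) \<and> decseq t \<and> t \<longlonglongrightarrow> 0 \<and> (\<forall>k. x k \<in> C) \<and> (\<lambda>k. t k *\<^sub>R x k) \<longlonglongrightarrow> u}"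
proof (intro equalityI subsetI)
  fix u assume "u \<in> horizon_cone C"
  then obtain t :: "nat \<Rightarrow> real" and x where
    tx: "\<And>k. t k > 0" "t \<longlonglongrightarrow> 0" "\<And>k. x k \<in> C" "(\<lambda>k. t k *\<^sub>R x k) \<longlonglongrightarrow> u"
    unfolding horizon_cone_def by blast
  obtain r :: "nat \<Rightarrow> nat" where r: "strict_mono r" "monoseq (\<lambda>n. t (r n))"
    using seq_monosub[of t] by blast
  have lim: "(\<lambda>n. t (r n)) \<longlonglongrightarrow> 0"
    using LIMSEQ_subseq_LIMSEQ[OF tx(2) r(1)] by (simp add: o_def)
  have "\<not> incseq (\<lambda>n. t (r n))"
    using incseq_le[OF _ lim, of 0] tx(1)[of "r 0"] by auto
  then have "decseq (\<lambda>n. t (r n))"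
    using r(2) by (simp add: monoseq_iff)
  moreover have "(\<lambda>n. t (r n) *\<^sub>R x (r n)) \<longlonglongrightarrow> u"
    using LIMSEQ_subseq_LIMSEQ[OF tx(4) r(1)] by (simp add: o_def)
  ultimately show "u \<in> {u. \<exists>(t :: nat \<Rightarrow> real) x. (\<forall>k. t k > 0) \<and> decseq t \<and> t \<longlonglongrightarrow> 0 \<and>
      (\<forall>k. x k \<in> C) \<and> (\<lambda>k. t k *\<^sub>R x k) \<longlonglongrightarrow> u}"
    using tx(1,3) lim
    by (intro CollectI exI[of _ "\<lambda>n. t (r n)"] exI[of _ "\<lambda>n. x (r n)"]) simp
qed (auto simp: horizon_cone_def)

end

theory Submission
  imports Defs
begin

text \<open>
  Write \<open>C\<close> for the closed convex hull of the graph. The epigraph is a closed convex set containing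
  the graph (as \<open>0 \<in> K\<close>), so it always contains \<open>C\<close>, and the equality is a matter of the opposite
  inclusion. A point of the epigraph is a point of the graph plus a vector of \<open>{0} \<times> K\<close>. Hence the
  epigraph lies in \<open>C\<close> as soon as \<open>C\<close> is stable under adding vectors of \<open>{0} \<times> K\<close>, and a closed
  convex set is stable under adding its horizon directions (\<open>add_horizon_cone_mem\<close>). Conversely, \<open>K\<close>
  being a cone, the epigraph contains the half-line in each direction of \<open>{0} \<times> K\<close> from any point of
  the graph, so these directions are horizon directions of the epigraph
  (\<open>horizon_coneI_ray\<close>).
\<close>

text \<open>
  The vector \<open>c + u\<close> is the limit of the convex combinations \<open>(1 - t\<^sub>k) c + t\<^sub>k x\<^sub>k\<close>, where
  \<open>t\<^sub>k x\<^sub>k \<rightarrow> u\<close> and \<open>t\<^sub>k \<rightarrow> 0\<close>.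
\<close>

lemma add_horizon_cone_mem:
  assumes "convex C" "closed C" "c \<in> C" "u \<in> horizon_cone C"
  shows "c + u \<in> C"
proof -
  obtain t :: "nat \<Rightarrow> real" and x where
    t: "\<And>k. t k > 0" "t \<longlonglongrightarrow> 0" and x: "\<And>k. x k \<in> C" "(\<lambda>k. t k *\<^sub>R x k) \<longlonglongrightarrow> u"
    using assms(4) unfolding horizon_cone_def by blast
  have "(\<lambda>k. (1 - t k) *\<^sub>R c + t k *\<^sub>R x k) \<longlonglongrightarrow> (1 - 0) *\<^sub>R c + u"
    by (intro tendsto_intros t(2) x(2))
  then have lim: "(\<lambda>k. (1 - t k) *\<^sub>R c + t k *\<^sub>R x k) \<longlonglongrightarrow> c + u"
    by simp
  have "\<forall>\<^sub>F k in sequentially. t k < 1"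
    using t(2) by (rule order_tendstoD) simp
  then have "\<forall>\<^sub>F k in sequentially. (1 - t k) *\<^sub>R c + t k *\<^sub>R x k \<in> C"
  proof eventually_elim
    case (elim k)
    then show ?case
      using assms(1,3) x(1) t(1)[of k] by (intro convexD) auto
  qed
  then show ?thesis
    by (rule Lim_in_closed_set[OF assms(2) _ sequentially_bot lim])
qed

text \<open>
  Scaling the point \<open>c + u / t\<close> of the half-line down by \<open>t\<close> gives \<open>t c + u\<close>, so the
  base point fades out as \<open>t \<rightarrow> 0\<close>.
\<close>

lemma horizon_coneI_ray:
  assumes ray: "\<And>s. s \<ge> 0 \<Longrightarrow> c + s *\<^sub>R u \<in> C"
  shows "u \<in> horizon_cone C"
proof -
  define t :: "nat \<Rightarrow> real" where "t k = inverse (real (Suc k))" for k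
  have pos: "t k > 0" for k
    by (simp add: t_def)
  have lim0: "t \<longlonglongrightarrow> 0"
    unfolding t_def by (rule LIMSEQ_inverse_real_of_nat)
  have "(\<lambda>k. t k *\<^sub>R c + u) \<longlonglongrightarrow> 0 *\<^sub>R c + u"
    by (intro tendsto_intros lim0)
  moreover have "t k *\<^sub>R (c + inverse (t k) *\<^sub>R u) = t k *\<^sub>R c + u" for k
    using pos[of k] by (simp add: scaleR_add_right)
  ultimately have "(\<lambda>k. t k *\<^sub>R (c + inverse (t k) *\<^sub>R u)) \<longlonglongrightarrow> u"
    by simp
  moreover have "c + inverse (t k) *\<^sub>R u \<in> C" for k
    using pos[of k] by (intro ray) simp
  ultimately show ?thesis
    using pos lim0 unfolding horizon_cone_def
    by (intro CollectI exI[of _ t] exI[of _ "\<lambda>k. c + inverse (t k) *\<^sub>R u"]) simp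
qed

lemma mem_K_epi_iff: "(x, y) \<in> K_epi K F \<longleftrightarrow> (\<exists>z. (x, z) \<in> Map.graph F \<and> y - z \<in> K)"
  by (auto simp: K_epi_def Map.graph_def)

lemma closed_convex_hull_minimal:
  assumes "S \<subseteq> T" "convex T" "closed T"
  shows "closed_convex_hull S \<subseteq> T"
  unfolding closed_convex_hull_def
  using assms by (intro closure_minimal hull_minimal)

lemma subset_closed_convex_hull: "S \<subseteq> closed_convex_hull S"
  unfolding closed_convex_hull_def by (rule subset_trans[OF hull_subset closure_subset])

lemma convex_closed_convex_hull: "convex (closed_convex_hull S)"
  unfolding closed_convex_hull_def by (intro convex_closure convex_convex_hull)

lemma closed_closed_convex_hull: "closed (closed_convex_hull S)"
  unfolding closed_convex_hull_def by (rule closed_closure)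

theorem theorem32:
  fixes K :: "'b::fin_dim_real_inner set"
    and F :: "'a::fin_dim_real_inner \<Rightarrow> 'b option"
  assumes "K \<noteq> {}" and "cone K" and "convex K" and "closed K"
    and "proper F" and "K_convex K F" and "K_closed K F"
  shows "K_epi K F = closed_convex_hull (Map.graph F) \<longleftrightarrow>
         {0} \<times> K \<subseteq> horizon_cone (closed_convex_hull (Map.graph F))"
proof
  let ?C = "closed_convex_hull (Map.graph F)"
  assume eq: "K_epi K F = ?C"
  obtain x z where xz: "(x, z) \<in> Map.graph F"
    using assms(5) by (auto simp: proper_def dom_def Map.graph_def)
  show "{0} \<times> K \<subseteq> horizon_cone ?C"
  proof clarify
    fix v assume v: "v \<in> K"
    have "(x, z) + s *\<^sub>R (0, v) \<in> ?C" if "s \<ge> 0" for s :: real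
    proof -
      have "s *\<^sub>R v \<in> K"
        using assms(2) v that by (simp add: cone_def)
      then have "(x, z + s *\<^sub>R v) \<in> K_epi K F"
        unfolding mem_K_epi_iff using xz by (intro exI[of _ z]) simp
      then show ?thesis
        using eq by simp
    qed
    then show "(0, v) \<in> horizon_cone ?C"
      by (rule horizon_coneI_ray)
  qed
next
  let ?C = "closed_convex_hull (Map.graph F)"
  assume hor: "{0} \<times> K \<subseteq> horizon_cone ?C"
  have "0 \<in> K"
    using assms(1,2) cone_contains_0 by blast
  then have "(x, z) \<in> K_epi K F" if "(x, z) \<in> Map.graph F" for x z
    unfolding mem_K_epi_iff using that by (intro exI[of _ z]) simp
  then have "Map.graph F \<subseteq> K_epi K F"
    by (rule subrelI)
  then have "?C \<subseteq> K_epi K F"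
    using assms(6,7) unfolding K_convex_def K_closed_def by (rule closed_convex_hull_minimal)
  moreover have "K_epi K F \<subseteq> ?C"
  proof clarify
    fix x y assume "(x, y) \<in> K_epi K F"
    then obtain z where z: "(x, z) \<in> Map.graph F" "y - z \<in> K"
      unfolding mem_K_epi_iff by blast
    have "(x, z) \<in> ?C"
      using z(1) subset_closed_convex_hull by blast
    moreover have "(0, y - z) \<in> horizon_cone ?C"
      using z(2) hor by blast
    ultimately have "(x, z) + (0, y - z) \<in> ?C"
      by (rule add_horizon_cone_mem[OF convex_closed_convex_hull closed_closed_convex_hull])
    then show "(x, y) \<in> ?C"
      by simp
  qed
  ultimately show "K_epi K F = ?C"
    by blast
qed

end
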